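(* Let $0<k\leq n$ be integers. In the unique optimal (minimal-length) solution of the Tower of Hanoi-Fibonacci with $n$ disks from $(\Delta_n,\varnothing,\varnothing)$ to $(\varnothing,\varnothing,\Delta_n)$, the number of $k$-Fibonacci moves is $F_{n+1-k}$.
   Context: Fibonacci numbers: $F_1=F_2=1$, $F_{m+2}=F_{m+1}+F_m$. Disks $1,\dots,n$, $\Delta_k=\{1,\dots,k\}$ ($\varnothing$ for $k<1$). A state is an ordered triple $(A,B,C)$ of disjoint sets with union $\Delta_n$ (each peg stacked in decreasing order, top = minimum). For $k\in\Delta_n$, a $k$-Fibonacci move is defined when two distinct pegs $X,Y$ satisfy $X=k\tilde X$, $Y=\Delta_{k-1}\tilde Y$ (all disks of $\tilde X,\tilde Y$ larger than $k$) and the third peg $Z$ contains only disks larger than $k$; it yields $\tilde{X}\sqcup \Delta_{k-2}\tilde{Y}\sqcup (k-1)kZ$ (disks $k-1,k$ put simultaneously onto $Z$; peg positions preserved). The Tower of Hanoi-Fibonacci allows only such moves; its minimal solution from $(\Delta_n,\varnothing,\varnothing)$ to $(\varnothing,\varnothing,\Delta_n)$ is unique. *)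

theory Defs
  imports "HOL-Number_Theory.Fib"
begin

datatype peg = PegA | PegB | PegC

definition Delta :: "nat \<Rightarrow> nat set" where
  "Delta k = {1..k}"

(* An ordered triple of disk sets, indexed by the pegs; the stacking order on a peg is
   determined by its set of disks, the top disk being the minimum. *)
type_synonym state = "peg \<Rightarrow> nat set"

definition is_state :: "nat \<Rightarrow> state \<Rightarrow> bool" where
  "is_state n s \<longleftrightarrow> (\<forall>P Q. P \<noteq> Q \<longrightarrow> s P \<inter> s Q = {}) \<and> (\<Union>P. s P) = Delta n"

definition all_on :: "nat \<Rightarrow> peg \<Rightarrow> state" where
  "all_on n P = (\<lambda>_. {})(P := Delta n)"

(* The truncated subtractions agree with the convention that Delta k is empty for k < 1.
   There is no disk 0, so for k = 1 only disk 1 is moved; hence the "- {0}". *)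
definition fib_move :: "nat \<Rightarrow> nat \<Rightarrow> state \<Rightarrow> state \<Rightarrow> bool" where
  "fib_move n k s t \<longleftrightarrow> is_state n s \<and> k \<in> Delta n \<and>
     (\<exists>X Y Z X' Y'. X \<noteq> Y \<and> X \<noteq> Z \<and> Y \<noteq> Z \<and>
        s X = {k} \<union> X' \<and> s Y = Delta (k - 1) \<union> Y' \<and>
        (\<forall>d \<in> X'. k < d) \<and> (\<forall>d \<in> Y'. k < d) \<and> (\<forall>d \<in> s Z. k < d) \<and>
        t X = X' \<and> t Y = Delta (k - 2) \<union> Y' \<and> t Z = ({k - 1, k} - {0}) \<union> s Z)"

(* A solution is given by the list of states it visits; its number of moves is one less
   than the length of this list. *)
definition is_solution :: "nat \<Rightarrow> state list \<Rightarrow> bool" where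
  "is_solution n ss \<longleftrightarrow> ss \<noteq> [] \<and> hd ss = all_on n PegA \<and> last ss = all_on n PegC \<and>
     successively (\<lambda>s t. \<exists>k. fib_move n k s t) ss"

definition is_optimal_solution :: "nat \<Rightarrow> state list \<Rightarrow> bool" where
  "is_optimal_solution n ss \<longleftrightarrow> is_arg_min length (is_solution n) ss"

definition num_moves :: "nat \<Rightarrow> nat \<Rightarrow> state list \<Rightarrow> nat" where
  "num_moves n k ss = card {i. Suc i < length ss \<and> fib_move n k (ss ! i) (ss ! Suc i)}"

end

(* Only an n-move displaces the largest disk n. Before the first n-move the tower of n - 1 disks
   has to be transferred to the spare peg; after the last one, disks n - 1 and n both lie on the
   destination, and the tower of n - 2 disks has to be transferred there. A second n-move is never
   worthwhile, so the optimal solution is unique and its move counts satisfy the Fibonacci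
   recurrence N(n, k) = N(n - 1, k) + [k = n] + N(n - 2, k). The induction also has to bound the
   second phase, where disk n - 1 already lies on its destination but might be displaced again. *)
theory Submission
  imports Defs
begin

section \<open>Configurations, legal moves and paths\<close>

text \<open>Recording the peg of each disk makes disjointness of the pegs automatic. Index 0 stands
  for no disk.\<close>

type_synonym config = "nat \<Rightarrow> peg"

text \<open>Determined only for distinct pegs; \<open>legal\<close> ensures this by
  \<open>p k \<noteq> Z\<close>.\<close>

definition third :: "peg \<Rightarrow> peg \<Rightarrow> peg" where
  "third X Y = (THE Z. Z \<noteq> X \<and> Z \<noteq> Y)"

lemma third_eqI: "X \<noteq> Y \<Longrightarrow> Z \<noteq> X \<Longrightarrow> Z \<noteq> Y \<Longrightarrow> third X Y = Z"
  unfolding third_def by (rule the_equality) (simp, metis peg.exhaust)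

lemma third_neq: "X \<noteq> Y \<Longrightarrow> third X Y \<noteq> X" "X \<noteq> Y \<Longrightarrow> third X Y \<noteq> Y"
proof -
  have "\<exists>Z. Z \<noteq> X \<and> Z \<noteq> Y"
    by (cases X; cases Y) (metis peg.distinct)+
  then obtain Z where "Z \<noteq> X" "Z \<noteq> Y" by blast
  then show "X \<noteq> Y \<Longrightarrow> third X Y \<noteq> X" "X \<noteq> Y \<Longrightarrow> third X Y \<noteq> Y"
    using third_eqI by metis+
qed

(* A pair (k, Z) stands for the k-Fibonacci move onto Z. *)
fun legal :: "config \<Rightarrow> nat \<times> peg \<Rightarrow> bool" where
  "legal p (k, Z) \<longleftrightarrow> 0 < k \<and> p k \<noteq> Z \<and> (\<forall>i. 0 < i \<and> i < k \<longrightarrow> p i = third (p k) Z)"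

text \<open>The guard selects disks k - 1 and k without subtraction; \<open>0 < i\<close> excludes
  the nonexistent disk 0 when k = 1.\<close>

fun move :: "config \<Rightarrow> nat \<times> peg \<Rightarrow> config" where
  "move p (k, Z) = (\<lambda>i. if 0 < i \<and> i \<le> k \<and> k \<le> Suc i then Z else p i)"

(* Disks above the bound m stay in place, so paths on a smaller tower are literally paths on a
   larger one. *)
primrec path :: "nat \<Rightarrow> config \<Rightarrow> (nat \<times> peg) list \<Rightarrow> config \<Rightarrow> bool" where
  "path m p [] q \<longleftrightarrow> q = p"
| "path m p (x # w) q \<longleftrightarrow> fst x \<le> m \<and> legal p x \<and> path m (move p x) w q"

lemma path_append: "path m p (u @ v) q \<longleftrightarrow> (\<exists>r. path m p u r \<and> path m r v q)"
  by (induction u arbitrary: p) auto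

lemma path_mono: "path m p w q \<Longrightarrow> m \<le> n \<Longrightarrow> path n p w q"
  by (induction w arbitrary: p) auto

lemma path_Suc_avoid:
  "path (Suc m) p w q \<Longrightarrow> Suc m \<notin> fst ` set w \<Longrightarrow> path m p w q"
  by (induction w arbitrary: p) auto

lemma path_frame: "path m p w q \<Longrightarrow> m < i \<Longrightarrow> q i = p i"
  by (induction w arbitrary: p) auto

lemma path_0: "path 0 p w q \<Longrightarrow> w = []"
  by (cases w) auto

text \<open>In the prefix the largest disk rests, so bounds for m disks apply to it; the suffix may
  still move that disk. \<open>path_last\<close> serves the phase after the final such move.\<close>

lemma path_first:
  assumes "path (Suc m) p w q" "Suc m \<in> fst ` set w"
  obtains u V v r where "w = u @ (Suc m, V) # v" "path m p u r" "legal r (Suc m, V)"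
    "path (Suc m) (move r (Suc m, V)) v q"
proof -
  have "\<exists>x\<in>set w. fst x = Suc m" using assms(2) by (metis imageE)
  then obtain u x v where w: "w = u @ x # v" "fst x = Suc m" "\<forall>y\<in>set u. fst y \<noteq> Suc m"
    using split_list_first_prop[of w "\<lambda>x. fst x = Suc m"] by blast
  obtain V where x: "x = (Suc m, V)" using w(2) by (cases x) auto
  obtain r where r: "path (Suc m) p u r" "legal r x" "path (Suc m) (move r x) v q"
    using assms(1) w(1) by (auto simp: path_append)
  have "path m p u r" using path_Suc_avoid[OF r(1)] w(3) by (metis imageE)
  then show thesis using that w(1) r x by blast
qed

lemma path_last:
  assumes "path (Suc m) p w q" "Suc m \<in> fst ` set w"
  obtains u V v r where "w = u @ (Suc m, V) # v" "legal r (Suc m, V)"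
    "path m (move r (Suc m, V)) v q"
proof -
  have "\<exists>x\<in>set w. fst x = Suc m" using assms(2) by (metis imageE)
  then obtain u x v where w: "w = u @ x # v" "fst x = Suc m" "\<forall>y\<in>set v. fst y \<noteq> Suc m"
    using split_list_last_prop[of w "\<lambda>x. fst x = Suc m"] by blast
  obtain V where x: "x = (Suc m, V)" using w(2) by (cases x) auto
  obtain r where r: "path (Suc m) p u r" "legal r x" "path (Suc m) (move r x) v q"
    using assms(1) w(1) by (auto simp: path_append)
  have "path m (move r x) v q" using path_Suc_avoid[OF r(3)] w(3) by (metis imageE)
  then show thesis using that w(1) r x by blast
qed

section \<open>Towers and the recursive solution\<close>

definition tower :: "nat \<Rightarrow> config \<Rightarrow> peg \<Rightarrow> bool" where
  "tower m p X \<longleftrightarrow> (\<forall>i. 0 < i \<and> i \<le> m \<longrightarrow> p i = X)"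

lemma tower_pred: "tower (Suc m) p X \<Longrightarrow> tower m p X"
  by (simp add: tower_def)

lemma tower_top: "tower (Suc m) p X \<Longrightarrow> p (Suc m) = X"
  by (simp add: tower_def)

text \<open>A move of the largest disk is rigid: the rule fixes the positions of all smaller disks
  just before and just after it. These are the endpoints to which the length bounds are
  applied.\<close>

lemma legal_tower:
  assumes "legal p (Suc m, V)"
  shows "p (Suc m) \<noteq> V" "tower m p (third (p (Suc m)) V)"
    "tower (m - 1) (move p (Suc m, V)) (third (p (Suc m)) V)"
    "move p (Suc m, V) (Suc m) = V" "0 < m \<Longrightarrow> move p (Suc m, V) m = V"
proof -
  show "p (Suc m) \<noteq> V" using assms by simp
  show *: "tower m p (third (p (Suc m)) V)"
    using assms by (simp add: tower_def)
  have "move p (Suc m, V) i = p i" if "i \<le> m - 1" "0 < i" for i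
    using that by auto
  then show "tower (m - 1) (move p (Suc m, V)) (third (p (Suc m)) V)"
    using * unfolding tower_def by (metis diff_le_self le_trans)
qed auto

(* For m = 0 the truncated m - 1 = 0 makes the last summand empty, as for the single disk. *)
fun opt :: "nat \<Rightarrow> peg \<Rightarrow> peg \<Rightarrow> (nat \<times> peg) list" where
  "opt 0 X W = []"
| "opt (Suc m) X W = opt m X (third X W) @ (Suc m, W) # opt (m - 1) (third X W) W"

text \<open>In closed form this is \<open>fib (m + 2) - 1\<close>.\<close>

fun optlen :: "nat \<Rightarrow> nat" where
  "optlen 0 = 0"
| "optlen (Suc m) = Suc (optlen m + optlen (m - 1))"

lemma length_opt: "length (opt m X W) = optlen m"
  by (induction m X W rule: opt.induct) auto

text \<open>For k \<le> m the two recursive calls contribute consecutive Fibonacci numbers. For k >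
  m the truncated subtraction gives \<open>fib 0 = 0\<close>, as it should.\<close>

lemma count_opt:
  "0 < k \<Longrightarrow> length (filter (\<lambda>x. fst x = k) (opt m X W)) = fib (Suc m - k)"
proof (induction m X W rule: opt.induct)
  case (2 m X W)
  consider "k = Suc m" | "Suc m < k" | "k \<le> m" by linarith
  then show ?case
  proof cases
    case 3
    then obtain j where "m = k + j" using le_Suc_ex by blast
    then show ?thesis using 2 by (auto simp: Suc_diff_le)
  qed (use 2 in auto)
qed simp

lemma path_opt:
  "X \<noteq> W \<Longrightarrow> tower m p X \<Longrightarrow> path m p (opt m X W) (\<lambda>i. if 0 < i \<and> i \<le> m then W else p i)"
proof (induction m X W arbitrary: p rule: opt.induct)
  case (1 X W)
  then show ?case by auto
next
  case (2 m X W)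
  let ?Y = "third X W"
  define r where "r = (\<lambda>i. if 0 < i \<and> i \<le> m then ?Y else p i)"
  have neq: "X \<noteq> ?Y" "?Y \<noteq> W" using third_neq 2(3) by metis+
  have u: "path (Suc m) p (opt m X ?Y) r"
    unfolding r_def using 2(1)[OF neq(1) tower_pred[OF 2(4)]] path_mono le_SucI by blast
  have l: "legal r (Suc m, W)"
    using 2(3,4) by (auto simp: r_def tower_def)
  let ?r = "move r (Suc m, W)"
  have "tower (m - 1) ?r ?Y" by (auto simp: tower_def r_def)
  then have v: "path (Suc m) ?r (opt (m - 1) ?Y W)
      (\<lambda>i. if 0 < i \<and> i \<le> m - 1 then W else ?r i)"
    using 2(2)[OF neq(2)] path_mono by (meson diff_le_self le_SucI le_trans)
  \<comment> \<open>The second phase treats only disks up to m - 1, because the move has already put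
    disks m and m + 1 on W.\<close>
  have "(\<lambda>i. if 0 < i \<and> i \<le> m - 1 then W else ?r i)
      = (\<lambda>i. if 0 < i \<and> i \<le> Suc m then W else p i)"
    by (auto simp: r_def fun_eq_iff)
  then show ?case using u l v by (auto simp: path_append simp del: legal.simps move.simps)
qed

section \<open>Lower bounds on path lengths\<close>

text \<open>The disjunction with a strict inequality expresses optimality and uniqueness at
  once.\<close>

definition tower_bound :: "nat \<Rightarrow> bool" where
  "tower_bound m \<longleftrightarrow> (\<forall>p w q X W. path m p w q \<longrightarrow> X \<noteq> W \<longrightarrow> tower m p X \<longrightarrow> tower m q W \<longrightarrow>
     w = opt m X W \<or> optlen m < length w)"

text \<open>The situation just after disk m + 2 has carried disk m + 1 to the destination W. The
  path bound \<open>Suc m\<close> leaves this cap free to move, so the claim also excludes detours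
  of the cap.\<close>

definition cap_bound :: "nat \<Rightarrow> bool" where
  "cap_bound m \<longleftrightarrow> (\<forall>p w q Y W. path (Suc m) p w q \<longrightarrow> Y \<noteq> W \<longrightarrow> tower m p Y \<longrightarrow>
     p (Suc m) = W \<longrightarrow> tower (Suc m) q W \<longrightarrow> w = opt m Y W \<or> optlen m < length w)"

lemma tower_boundD:
  "tower_bound m \<Longrightarrow> path m p w q \<Longrightarrow> X \<noteq> W \<Longrightarrow> tower m p X \<Longrightarrow> tower m q W \<Longrightarrow>
   w = opt m X W \<or> optlen m < length w"
  unfolding tower_bound_def by blast

lemma cap_boundD:
  "cap_bound m \<Longrightarrow> path (Suc m) p w q \<Longrightarrow> Y \<noteq> W \<Longrightarrow> tower m p Y \<Longrightarrow>
   p (Suc m) = W \<Longrightarrow> tower (Suc m) q W \<Longrightarrow> w = opt m Y W \<or> optlen m < length w"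
  unfolding cap_bound_def by blast

text \<open>Disk m + 1 rests throughout v, so its target must be W. Disk m came along and is the cap
  over which the remaining m - 1 disks are transferred; for m = 0 nothing remains.\<close>

lemma final_phase:
  assumes "0 < m \<Longrightarrow> cap_bound (m - 1)"
    and "legal r (Suc m, V)" "path m (move r (Suc m, V)) v q" "tower (Suc m) q W"
  shows "V = W \<and> (v = opt (m - 1) (third (r (Suc m)) W) W \<or> optlen (m - 1) < length v)"
proof -
  note lt = legal_tower[OF assms(2)]
  have V: "V = W"
    using path_frame[OF assms(3), of "Suc m"] lt(4) tower_top[OF assms(4)] by simp
  show ?thesis
  proof (cases m)
    case 0
    then show ?thesis using V assms(3) path_0 by auto
  next
    case (Suc j)
    have "v = opt j (third (r (Suc m)) W) W \<or> optlen j < length v"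
    proof (rule cap_boundD)
      show "cap_bound j" using assms(1) Suc by simp
      show "path (Suc j) (move r (Suc m, V)) v q" using assms(3) Suc by simp
      show "third (r (Suc m)) W \<noteq> W" using third_neq(2)[OF lt(1)] V by simp
      show "tower j (move r (Suc m, V)) (third (r (Suc m)) W)" using lt(3) V Suc by simp
      show "move r (Suc m, V) (Suc j) = W" using lt(5) V Suc by simp
      show "tower (Suc j) q W" using tower_pred[OF assms(4)] Suc by simp
    qed
    then show ?thesis using V Suc by simp
  qed
qed

lemma after_move_bound:
  assumes "0 < m \<Longrightarrow> cap_bound (m - 1)"
    and "legal r (Suc m, V)" "path (Suc m) (move r (Suc m, V)) v q" "tower (Suc m) q W"
  shows "optlen (m - 1) \<le> length v"
proof -
  \<comment> \<open>Prepending the given move guarantees that a last move of disk m + 1 exists,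
    whether or not v contains one; what follows it is a suffix of v.\<close>
  have "path (Suc m) r ((Suc m, V) # v) q" using assms by simp
  then obtain u V' v' r' where *: "(Suc m, V) # v = u @ (Suc m, V') # v'" "legal r' (Suc m, V')"
    "path m (move r' (Suc m, V')) v' q"
    by (rule path_last) auto
  have "optlen (m - 1) \<le> length v'"
    using final_phase[OF assms(1) *(2,3) assms(4)] length_opt by auto
  moreover have "length v' \<le> length v" using arg_cong[OF *(1), of length] by simp
  ultimately show ?thesis by simp
qed

text \<open>A cruder bound that assumes nothing about the initial positions of the smaller disks:
  disk m + 1 must move at least once, and the phase after that move is bounded already.\<close>

lemma changed_peg_bound:
  assumes "0 < m \<Longrightarrow> cap_bound (m - 1)"
    and "path (Suc m) p w q" "p (Suc m) \<noteq> W" "tower (Suc m) q W"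
  shows "Suc (optlen (m - 1)) \<le> length w"
proof -
  have "Suc m \<in> fst ` set w"
    using path_frame[OF path_Suc_avoid[OF assms(2)], of "Suc m"] tower_top[OF assms(4)] assms(3)
    by auto
  with assms(2) obtain u V v r where *: "w = u @ (Suc m, V) # v" "legal r (Suc m, V)"
      "path (Suc m) (move r (Suc m, V)) v q"
    by (rule path_first)
  show ?thesis using after_move_bound[OF assms(1) *(2,3) assms(4)] *(1) by simp
qed

lemma tower_bound_Suc:
  assumes "tower_bound m" "0 < m \<Longrightarrow> cap_bound (m - 1)"
  shows "tower_bound (Suc m)"
  unfolding tower_bound_def
proof (intro allI impI)
  fix p w q X W
  assume w: "path (Suc m) p w q" and XW: "X \<noteq> W"
    and p: "tower (Suc m) p X" and q: "tower (Suc m) q W"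
  have "Suc m \<in> fst ` set w"
    using path_frame[OF path_Suc_avoid[OF w], of "Suc m"] tower_top[OF p] tower_top[OF q] XW
    by auto
  with w obtain u V v r where *: "w = u @ (Suc m, V) # v" "path m p u r" "legal r (Suc m, V)"
      "path (Suc m) (move r (Suc m, V)) v q"
    by (rule path_first)
  note lt = legal_tower[OF *(3)]
  have r: "r (Suc m) = X" using path_frame[OF *(2), of "Suc m"] tower_top[OF p] by simp
  \<comment> \<open>The target V is not yet known to be W, but \<open>optlen m\<close> bounds the
    first phase for every target.\<close>
  have u: "u = opt m X (third X V) \<or> optlen m < length u"
    using tower_boundD[OF assms(1) *(2) _ tower_pred[OF p]] lt(1,2) third_neq(1) r by metis
  then have lu: "optlen m \<le> length u" using length_opt by auto
  show "w = opt (Suc m) X W \<or> optlen (Suc m) < length w"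
  proof (cases "Suc m \<in> fst ` set v")
    case True
    from *(4) True obtain u' V' v' r' where **: "v = u' @ (Suc m, V') # v'"
        "legal r' (Suc m, V')" "path (Suc m) (move r' (Suc m, V')) v' q"
      by (rule path_first)
    \<comment> \<open>Two moves of the largest disk give at least
      \<open>optlen m + 2 + optlen (m - 1)\<close> moves, one more than
      \<open>optlen (Suc m)\<close>.\<close>
    show ?thesis
      using after_move_bound[OF assms(2) **(2,3) q] lu *(1) **(1) by simp
  next
    case False
    show ?thesis
      using final_phase[OF assms(2) *(3) path_Suc_avoid[OF *(4) False] q] u lu *(1) r length_opt
      by auto
  qed
qed

(* If disk m + 1 leaves its destination it must come back, and disk m, which was carried along,
   has to leave it in between; this costs more than the direct transfer of the m smaller disks. *)
lemma cap_bound_step: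
  assumes "tower_bound m" "\<And>j. j < m \<Longrightarrow> cap_bound j"
  shows "cap_bound m"
  unfolding cap_bound_def
proof (intro allI impI)
  fix p w q Y W
  assume w: "path (Suc m) p w q" and YW: "Y \<noteq> W" and pY: "tower m p Y"
    and pW: "p (Suc m) = W" and q: "tower (Suc m) q W"
  have cap: "0 < m \<Longrightarrow> cap_bound (m - 1)" "0 < m - 1 \<Longrightarrow> cap_bound (m - 1 - 1)"
    using assms(2) by simp_all
  show "w = opt m Y W \<or> optlen m < length w"
  proof (cases "Suc m \<in> fst ` set w")
    case False
    show ?thesis
      using tower_boundD[OF assms(1) path_Suc_avoid[OF w False] YW pY tower_pred[OF q]] .
  next
    case True
    with w obtain u V v r where *: "w = u @ (Suc m, V) # v" "path m p u r" "legal r (Suc m, V)"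
        "path (Suc m) (move r (Suc m, V)) v q"
      by (rule path_first)
    note lt = legal_tower[OF *(3)]
    have "V \<noteq> W" using lt(1) path_frame[OF *(2), of "Suc m"] pW by simp
    then have "Suc m \<in> fst ` set v"
      using path_frame[OF path_Suc_avoid[OF *(4)], of "Suc m"] lt(4) tower_top[OF q] by auto
    with *(4) obtain u' V' v' r' where **: "v = u' @ (Suc m, V') # v'"
        "path m (move r (Suc m, V)) u' r'"
        "legal r' (Suc m, V')" "path (Suc m) (move r' (Suc m, V')) v' q"
      by (rule path_first)
    note lt' = legal_tower[OF **(3)]
    have r'V: "r' (Suc m) = V" using path_frame[OF **(2), of "Suc m"] lt(4) by simp
    have v': "optlen (m - 1) \<le> length v'" using after_move_bound[OF cap(1) **(3,4) q] .
    show ?thesis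
    proof (cases m)
      case 0
      then show ?thesis using *(1) by simp
    next
      case (Suc j)
      \<comment> \<open>After the first move of disk j + 2, disk j + 1 lies on V beside it; the next
        move of disk j + 2, from V to V', requires disk j + 1 on the third peg.\<close>
      have "Suc (optlen (j - 1)) \<le> length u'"
      proof (rule changed_peg_bound)
        show "cap_bound (j - 1)" if "0 < j" using cap(2) Suc that by simp
        show "path (Suc j) (move r (Suc m, V)) u' r'" using **(2) Suc by simp
        show "move r (Suc m, V) (Suc j) \<noteq> third V V'"
          using lt(5) third_neq(1)[OF lt'(1)] r'V Suc by simp
        show "tower (Suc j) r' (third V V')" using lt'(2) r'V Suc by simp
      qed
      \<comment> \<open>The two cap moves, u' and v' together give at least
        \<open>optlen j + optlen (j - 1) + 3\<close> moves, against
        \<open>optlen j + optlen (j - 1) + 1\<close> for the direct transfer.\<close>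
      then show ?thesis using v' *(1) **(1) Suc by simp
    qed
  qed
qed

lemma tower_bound: "tower_bound m"
proof -
  have "tower_bound m \<and> cap_bound m"
  \<comment> \<open>The bounds reach two levels down, hence strong induction. Within one level the
    tower bound comes first, since the cap bound relies on it when the cap rests.\<close>
  proof (induction m rule: less_induct)
    case (less m)
    have "tower_bound m"
    proof (cases m)
      case 0
      then show ?thesis using path_0 by (auto simp: tower_bound_def)
    next
      case (Suc j)
      then show ?thesis using tower_bound_Suc[of j] less by simp
    qed
    then show ?case using cap_bound_step less by blast
  qed
  then show ?thesis by simp
qed

section \<open>States represented by configurations\<close>

definition state_of :: "nat \<Rightarrow> config \<Rightarrow> state" where
  "state_of n p = (\<lambda>P. {i \<in> Delta n. p i = P})"

lemma state_of_eqD: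
  assumes "state_of n p = state_of n q" "0 < i" "i \<le> n"
  shows "p i = q i"
proof -
  have "i \<in> state_of n p (p i)" using assms(2,3) by (simp add: state_of_def Delta_def)
  then have "i \<in> state_of n q (p i)" using assms(1) by simp
  then show ?thesis by (simp add: state_of_def)
qed

lemma is_state_state_of: "is_state n (state_of n p)"
  by (auto simp: is_state_def state_of_def)

lemma all_on_eq: "all_on n X = state_of n (\<lambda>_. X)"
  by (auto simp: all_on_def state_of_def fun_eq_iff)

text \<open>The three pegs in the form in which \<open>fib_move\<close> describes them. The last
  equation requires k \<le> n, as \<open>state_of\<close> discards larger disks; for k = 1 the
  subtracted element 0 is no disk.\<close>

lemma state_of_move_cases:
  assumes "legal p (k, Z)"
  shows "state_of n (move p (k, Z)) (p k) = state_of n p (p k) - {k}"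
    "state_of n (move p (k, Z)) (third (p k) Z) = state_of n p (third (p k) Z) - {k - 1}"
    "k \<le> n \<Longrightarrow> state_of n (move p (k, Z)) Z = ({k - 1, k} - {0}) \<union> state_of n p Z"
proof -
  obtain X Y where XY: "p k = X" "third X Z = Y" by blast
  then have "0 < k" and neq: "X \<noteq> Z" "X \<noteq> Y" "Y \<noteq> Z" and small: "\<And>i. 0 < i \<Longrightarrow> i < k \<Longrightarrow> p i = Y"
    using assms third_neq[of X Z] by auto
  have k: "p k = X" "move p (k, Z) k = Z" using XY \<open>0 < k\<close> by auto
  have k1: "p (k - 1) = Y" "move p (k, Z) (k - 1) = Z" if "1 < k"
    using small[of "k - 1"] that by auto
  have other: "move p (k, Z) i = p i" if "i \<noteq> k" "i \<noteq> k - 1" for i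
    using that by auto
  note [simp del] = move.simps legal.simps
  have eq: "(i \<in> state_of n (move p (k, Z)) X) = (i \<in> state_of n p X - {k}) \<and>
    (i \<in> state_of n (move p (k, Z)) Y) = (i \<in> state_of n p Y - {k - 1}) \<and>
    (k \<le> n \<longrightarrow> (i \<in> state_of n (move p (k, Z)) Z) = (i \<in> ({k - 1, k} - {0}) \<union> state_of n p Z))" for i
  proof -
    consider "i = 0" | "i = k" | "i = k - 1" "1 < k" | "0 < i" "i \<noteq> k" "i \<noteq> k - 1" by linarith
    then show ?thesis
    proof cases
      case 2
      then show ?thesis using k \<open>0 < k\<close> neq by (auto simp: state_of_def Delta_def)
    next
      case 3
      then show ?thesis using k1 neq by (auto simp: state_of_def Delta_def)
    next
      case 4
      then show ?thesis using other[OF 4(2,3)] 4 by (auto simp: state_of_def Delta_def)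
    qed (auto simp: state_of_def Delta_def)
  qed
  show "state_of n (move p (k, Z)) (p k) = state_of n p (p k) - {k}"
    "state_of n (move p (k, Z)) (third (p k) Z) = state_of n p (third (p k) Z) - {k - 1}"
    "k \<le> n \<Longrightarrow> state_of n (move p (k, Z)) Z = ({k - 1, k} - {0}) \<union> state_of n p Z"
    unfolding set_eq_iff k(1) XY(2) using eq by blast+
qed

text \<open>The existential witnesses in \<open>fib_move\<close> are determined by k and Z: X is the
  peg of k and Y the third peg. Moreover, every successor of a represented state is again
  represented.\<close>

lemma fib_move_state_of:
  "fib_move n k (state_of n p) t \<longleftrightarrow>
   k \<le> n \<and> (\<exists>Z. legal p (k, Z) \<and> t = state_of n (move p (k, Z)))" (is "?L \<longleftrightarrow> ?R")
proof
  assume ?L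
  then obtain X Y Z X' Y' where k: "0 < k" "k \<le> n" and neq: "X \<noteq> Y" "X \<noteq> Z" "Y \<noteq> Z"
    and s: "state_of n p X = {k} \<union> X'" "state_of n p Y = Delta (k - 1) \<union> Y'"
    and gt: "\<forall>d \<in> X'. k < d" "\<forall>d \<in> Y'. k < d"
    and t: "t X = X'" "t Y = Delta (k - 2) \<union> Y'" "t Z = ({k - 1, k} - {0}) \<union> state_of n p Z"
    unfolding fib_move_def by (auto simp: Delta_def)
  have pk: "p k = X" using s(1) by (auto simp: state_of_def)
  have Y: "third X Z = Y" using neq by (metis third_eqI)
  have "p i = Y" if "0 < i" "i < k" for i
  proof -
    have "i \<in> Delta (k - 1)" using that by (auto simp: Delta_def)
    then have "i \<in> state_of n p Y" unfolding s(2) by blast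
    then show ?thesis by (simp add: state_of_def)
  qed
  then have l: "legal p (k, Z)" using k(1) pk neq(2) Y by simp
  have "t P = state_of n (move p (k, Z)) P" for P
  proof -
    \<comment> \<open>This survives truncation: for k = 1 both sides are empty.\<close>
    have D: "Delta (k - 2) = Delta (k - 1) - {k - 1}" by (auto simp: Delta_def)
    consider "P = X" | "P = Y" | "P = Z" using neq by (metis third_eqI)
    then show ?thesis
    proof cases
      case 1
      then show ?thesis
        using state_of_move_cases(1)[OF l, of n] s(1) t(1) gt(1) pk by auto
    next
      case 2
      have "k - 1 \<notin> Y'" using gt(2) by fastforce
      then show ?thesis
        using 2 state_of_move_cases(2)[OF l, of n] s(2) t(2) D pk Y by auto
    next
      case 3
      then show ?thesis using state_of_move_cases(3)[OF l k(2)] t(3) by simp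
    qed
  qed
  then show ?R using l k by blast
next
  assume ?R
  then obtain Z where k: "k \<le> n" and l: "legal p (k, Z)"
    and t: "t = state_of n (move p (k, Z))" by blast
  obtain X Y where XY: "p k = X" "third (p k) Z = Y" by blast
  define X' where "X' = state_of n p X - {k}"
  define Y' where "Y' = state_of n p Y - Delta (k - 1)"
  have neq: "X \<noteq> Y" "X \<noteq> Z" "Y \<noteq> Z" and "0 < k"
    using l XY third_neq[of X Z] by auto
  have small: "\<And>i. 0 < i \<Longrightarrow> i < k \<Longrightarrow> p i = Y" using l XY(2) by simp
  have sX: "state_of n p X = {k} \<union> X'"
    using \<open>0 < k\<close> k XY(1) by (auto simp: X'_def state_of_def Delta_def)
  have sY: "state_of n p Y = Delta (k - 1) \<union> Y'"
    using k small by (auto simp: Y'_def state_of_def Delta_def)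
  \<comment> \<open>All disks below k lie on Y, so any other disk off Y exceeds k. This yields the
    conditions on X' and on Z, the latter being only implicit in \<open>legal\<close>.\<close>
  have large: "k < d" if "p d \<noteq> Y" "d \<noteq> k" "0 < d" for d
    using small that by (metis linorder_neqE_nat)
  have gX: "\<forall>d \<in> X'. k < d"
    using large neq by (auto simp: X'_def state_of_def Delta_def)
  have gZ: "\<forall>d \<in> state_of n p Z. k < d"
  proof
    fix d assume "d \<in> state_of n p Z"
    then have "p d = Z" "0 < d" by (auto simp: state_of_def Delta_def)
    then show "k < d" using large neq XY(1) by metis
  qed
  have gY: "\<forall>d \<in> Y'. k < d"
  proof
    fix d assume "d \<in> Y'"
    then have "\<not> d \<le> k - 1" "d \<noteq> k"
      using neq(1) XY(1) by (auto simp: Y'_def state_of_def Delta_def)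
    then show "k < d" by linarith
  qed
  have tX: "t X = X'" using t state_of_move_cases(1)[OF l] XY(1) by (simp add: X'_def)
  have D: "Delta (k - 2) = Delta (k - 1) - {k - 1}" by (auto simp: Delta_def)
  have "k - 1 \<notin> Y'" using gY by fastforce
  then have tY: "t Y = Delta (k - 2) \<union> Y'"
    using t state_of_move_cases(2)[OF l, of n] sY D XY(2) by auto
  have tZ: "t Z = ({k - 1, k} - {0}) \<union> state_of n p Z"
    using t state_of_move_cases(3)[OF l k] by simp
  have "k \<in> Delta n" using \<open>0 < k\<close> k by (simp add: Delta_def)
  then show ?L
    unfolding fib_move_def using is_state_state_of neq sX sY gX gY gZ tX tY tZ
    by (intro conjI exI[of _ X] exI[of _ Y] exI[of _ Z] exI[of _ X'] exI[of _ Y'])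
qed

text \<open>The disk with the larger index would change its peg under one move and rest under the
  other. Hence \<open>num_moves\<close> never counts a step under two indices.\<close>

lemma fib_move_index_unique:
  assumes "fib_move n k (state_of n p) t" "fib_move n k' (state_of n p) t"
  shows "k = k'"
proof -
  have False if lt: "j < j'" and "fib_move n j (state_of n p) t"
    and "fib_move n j' (state_of n p) t" for j j'
  proof -
    obtain Z Z' where *: "t = state_of n (move p (j, Z))" "t = state_of n (move p (j', Z'))"
      "legal p (j', Z')" "j' \<le> n"
      using \<open>fib_move n j _ _\<close> \<open>fib_move n j' _ _\<close> unfolding fib_move_state_of by blast
    have "0 < j'" using lt by simp
    then have "move p (j, Z) j' = move p (j', Z') j'"
      using state_of_eqD *(1,2,4) by metis
    then show False using lt *(3) by simp
  qed
  then show ?thesis using assms by (metis linorder_neqE_nat)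
qed

section \<open>Solutions as traces of paths\<close>

primrec trace :: "config \<Rightarrow> (nat \<times> peg) list \<Rightarrow> config list" where
  "trace p [] = [p]"
| "trace p (x # w) = p # trace (move p x) w"

lemma length_trace [simp]: "length (trace p w) = Suc (length w)"
  by (induction w arbitrary: p) auto

lemma trace_eq_Cons: "\<exists>xs. trace p w = p # xs"
  by (cases w) auto

lemma last_trace: "path n p w q \<Longrightarrow> last (trace p w) = q"
proof (induction w arbitrary: p)
  case (Cons x w)
  then show ?case using trace_eq_Cons[of "move p x" w] by auto
qed simp

lemma trace_nth:
  "path n p w q \<Longrightarrow> i < length w \<Longrightarrow> fst (w ! i) \<le> n \<and> legal (trace p w ! i) (w ! i) \<and>
   trace p w ! Suc i = move (trace p w ! i) (w ! i)"
proof (induction w arbitrary: p i)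
  case (Cons x w)
  show ?case
  proof (cases i)
    case 0
    then show ?thesis using Cons.prems trace_eq_Cons[of "move p x" w] by auto
  next
    case (Suc j)
    then show ?thesis
      using Cons.IH[of "move p x" j] Cons.prems by (simp del: legal.simps move.simps)
  qed
qed simp

text \<open>Each step realizes the index recorded in w and, by \<open>fib_move_index_unique\<close>,
  no other, so counting pairs of states amounts to counting entries of w.\<close>

lemma num_moves_trace:
  assumes "path n p w q"
  shows "num_moves n k (map (state_of n) (trace p w)) = length (filter (\<lambda>x. fst x = k) w)"
proof -
  have "fib_move n k (map (state_of n) (trace p w) ! i) (map (state_of n) (trace p w) ! Suc i)
      \<longleftrightarrow> fst (w ! i) = k" if i: "i < length w" for i
  proof -
    have "fib_move n (fst (w ! i)) (state_of n (trace p w ! i)) (state_of n (trace p w ! Suc i))"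
      unfolding fib_move_state_of using trace_nth[OF assms i] by (metis prod.collapse)
    then show ?thesis using i fib_move_index_unique by auto
  qed
  then have "{i. Suc i < length (map (state_of n) (trace p w)) \<and>
      fib_move n k (map (state_of n) (trace p w) ! i) (map (state_of n) (trace p w) ! Suc i)}
      = {i. i < length w \<and> fst (w ! i) = k}"
    by auto
  then show ?thesis unfolding num_moves_def length_filter_conv_card by simp
qed

lemma successively_trace:
  "path n p w q \<Longrightarrow> successively (\<lambda>s t. \<exists>k. fib_move n k s t) (map (state_of n) (trace p w))"
proof (induction w arbitrary: p)
  case (Cons x w)
  then have "\<exists>k. fib_move n k (state_of n p) (state_of n (move p x))"
    unfolding fib_move_state_of by (metis path.simps(2) prod.collapse)
  moreover obtain xs where "trace (move p x) w = move p x # xs" using trace_eq_Cons by blast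
  ultimately show ?case
    using Cons.IH[of "move p x"] Cons.prems by (simp del: legal.simps move.simps)
qed simp

text \<open>Lifts a sequence of states to configurations step by step, from any representative p of
  the first state.\<close>

lemma successively_obtain_trace:
  "successively (\<lambda>s t. \<exists>k. fib_move n k s t) (state_of n p # ss) \<Longrightarrow>
   \<exists>w q. path n p w q \<and> state_of n p # ss = map (state_of n) (trace p w)"
proof (induction ss arbitrary: p)
  case Nil
  show ?case by (intro exI[of _ "[]"] exI[of _ p]) simp
next
  case (Cons t ss)
  then obtain k where "fib_move n k (state_of n p) t"
    and ss: "successively (\<lambda>s t. \<exists>k. fib_move n k s t) (t # ss)" by auto
  then obtain Z where Z: "k \<le> n" "legal p (k, Z)" "t = state_of n (move p (k, Z))"
    unfolding fib_move_state_of by blast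
  from Cons.IH ss Z(3) obtain w q where "path n (move p (k, Z)) w q"
    "t # ss = map (state_of n) (trace (move p (k, Z)) w)" by metis
  then have "path n p ((k, Z) # w) q \<and>
      state_of n p # t # ss = map (state_of n) (trace p ((k, Z) # w))"
    using Z by (simp del: legal.simps move.simps)
  then show ?case by (intro exI)
qed

text \<open>The end is described by \<open>tower\<close> rather than by a constant configuration,
  because q keeps the value \<open>PegA\<close> at 0 and above n.\<close>

lemma is_solution_iff:
  "is_solution n ss \<longleftrightarrow> (\<exists>w q. path n (\<lambda>_. PegA) w q \<and> tower n q PegC \<and>
     ss = map (state_of n) (trace (\<lambda>_. PegA) w))" (is "?L \<longleftrightarrow> ?R")
proof
  assume L: ?L
  then obtain xs where ss: "ss = state_of n (\<lambda>_. PegA) # xs"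
    by (cases ss) (auto simp: is_solution_def all_on_eq)
  then obtain w q where w: "path n (\<lambda>_. PegA) w q" "ss = map (state_of n) (trace (\<lambda>_. PegA) w)"
    using successively_obtain_trace[of n "\<lambda>_. PegA" xs] L unfolding is_solution_def by metis
  have "trace (\<lambda>_. PegA) w \<noteq> []" by (metis length_trace list.size(3) nat.distinct(1))
  then have "state_of n q = state_of n (\<lambda>_. PegC)"
    using L w last_trace[OF w(1)] by (simp add: is_solution_def all_on_eq last_map)
  then have "tower n q PegC" using state_of_eqD[of n q] by (auto simp: tower_def)
  then show ?R using w by blast
next
  assume ?R
  then obtain w q where w: "path n (\<lambda>_. PegA) w q" "tower n q PegC"
    "ss = map (state_of n) (trace (\<lambda>_. PegA) w)" by metis
  obtain xs where xs: "trace (\<lambda>_. PegA) w = (\<lambda>_. PegA) # xs" using trace_eq_Cons by blast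
  then have "trace (\<lambda>_. PegA) w \<noteq> []" by simp
  then have "last ss = state_of n q"
    using w(3) last_trace[OF w(1)] by (simp add: last_map)
  moreover have "state_of n q = all_on n PegC"
    using w(2) by (auto simp: all_on_eq state_of_def tower_def Delta_def fun_eq_iff)
  ultimately show ?L
    unfolding is_solution_def using successively_trace[OF w(1)] w(3) xs by (simp add: all_on_eq)
qed

section \<open>The optimal solution and its move counts\<close>

text \<open>A trace is one entry longer than its path, so the strict alternative in
  \<open>tower_bound\<close> makes every other solution strictly longer.\<close>

lemma is_optimal_solution_iff:
  "is_optimal_solution n ss \<longleftrightarrow>
   ss = map (state_of n) (trace (\<lambda>_. PegA) (opt n PegA PegC))" (is "_ \<longleftrightarrow> ss = ?opt")
proof -
  have start: "tower n (\<lambda>_. PegA) PegA" by (simp add: tower_def)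
  have opt: "is_solution n ?opt"
    unfolding is_solution_iff using path_opt[OF _ start, of PegC] by (force simp: tower_def)
  have "ss = ?opt \<or> length ?opt < length ss" if sol: "is_solution n ss" for ss
  proof -
    obtain w q where w: "path n (\<lambda>_. PegA) w q" "tower n q PegC"
      "ss = map (state_of n) (trace (\<lambda>_. PegA) w)"
      using sol unfolding is_solution_iff by metis
    have "w = opt n PegA PegC \<or> optlen n < length w"
      using tower_boundD[OF tower_bound w(1) _ start w(2)] by simp
    then show ?thesis using w(3) by (auto simp: length_opt)
  qed
  then show ?thesis
    using opt unfolding is_optimal_solution_def is_arg_min_def by (metis not_less_iff_gr_or_eq)
qed

theorem theorem2p4:
  fixes k n :: nat
  assumes "0 < k" and "k \<le> n"
  shows "(\<exists>!ss. is_optimal_solution n ss) \<and>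
         (\<forall>ss. is_optimal_solution n ss \<longrightarrow> num_moves n k ss = fib (n + 1 - k))"
proof -
  have "path n (\<lambda>_. PegA) (opt n PegA PegC) (\<lambda>i. if 0 < i \<and> i \<le> n then PegC else PegA)"
    by (rule path_opt) (simp_all add: tower_def)
  \<comment> \<open>Optimality has become an equation for \<open>ss\<close>, which settles existence
    and uniqueness; the count is then read off \<open>opt\<close>.\<close>
  from num_moves_trace[OF this, of k] show ?thesis
    unfolding is_optimal_solution_iff by (simp add: count_opt[OF assms(1)])
qed

end
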